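(* Let $S$ be the semigroup, under composition of functions, of all maps $f:\mathbb N_0\to\mathbb N_0$ for which there exists a finite (possibly empty) set $F\subset\mathbb N$ such that $f$ maps $F$ injectively into $\mathbb N$ and $f(n)=0$ for all $n\in\mathbb N_0\setminus F$. Then there is no locally compact Hausdorff topology $\sigma$ on $S$ such that $C_0(S,\sigma)$ is a predual for $\ell^1(S)$.
   Context: $\mathbb N=\{1,2,3,\dots\}$ and $\mathbb N_0=\mathbb N\cup\{0\}$. For a semigroup $S$ (discrete), $\ell^1(S)$ is the complex convolution Banach algebra with standard unit vectors $(\delta_s)_{s\in S}$ and product determined by $\delta_s\delta_t=\delta_{st}$; its dual is identified with $\ell^\infty(S)$, with bimodule actions $(\delta_s\cdot f)(t)=f(ts)$ and $(f\cdot\delta_s)(t)=f(st)$. A predual of a Banach algebra $A$ is a norm-closed sub-bimodule $E\subseteq A^*$ which is a Banach space predual of $A$, i.e. the canonical map $A\to E^*$, $a\mapsto(\mu\mapsto\mu(a))$, is a linear isomorphism (bijective and bicontinuous, not necessarily isometric). For a locally compact Hausdorff topology $\sigma$ on $S$, $C_0(S,\sigma)$ is the space of $\sigma$-continuous complex functions on $S$ vanishing at infinity, regarded as a subspace of $\ell^\infty(S)$. *)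

theory Defs
  imports "HOL-Analysis.Analysis"
begin

text \<open>Absolute summability is that of \<^theory>\<open>HOL-Analysis.Infinite_Sum\<close>.\<close>

no_notation Infinite_Set_Sum.abs_summable_on (infix "abs'_summable'_on" 50)

section \<open>Complex Banach algebras, duals and preduals\<close>

text \<open>
  The library has no class of complex normed algebras, so complex scalar multiplication is
  added to a (real, not necessarily unital) Banach algebra.
\<close>

class complex_banach_algebra = real_normed_algebra + banach +
  fixes scaleC :: "complex \<Rightarrow> 'a \<Rightarrow> 'a"
  assumes scaleC_add_right: "scaleC c (x + y) = scaleC c x + scaleC c y"
    and scaleC_add_left: "scaleC (c + d) x = scaleC c x + scaleC d x"
    and scaleC_scaleC: "scaleC c (scaleC d x) = scaleC (c * d) x"
    and scaleC_of_real: "scaleC (complex_of_real r) x = scaleR r x"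
    and scaleC_mult_left: "scaleC c x * y = scaleC c (x * y)"
    and scaleC_mult_right: "x * scaleC c y = scaleC c (x * y)"
    and norm_scaleC: "norm (scaleC c x) = cmod c * norm x"

text \<open>
  \<^typ>\<open>'a \<Rightarrow>\<^sub>L complex\<close> consists of the bounded real-linear maps; the dual is the
  subset of the complex-linear ones, with the operator norm inherited from that type.
\<close>

definition dual :: "('a::complex_banach_algebra \<Rightarrow>\<^sub>L complex) set" where
  "dual = {\<mu>. \<forall>c x. blinfun_apply \<mu> (scaleC c x) = c * blinfun_apply \<mu> x}"

definition scale_fun :: "complex \<Rightarrow> ('a::real_normed_vector \<Rightarrow>\<^sub>L complex) \<Rightarrow> ('a \<Rightarrow>\<^sub>L complex)" where
  "scale_fun c \<mu> = blinfun_mult_right c o\<^sub>L \<mu>"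

definition left_action :: "'a::real_normed_algebra \<Rightarrow> ('a \<Rightarrow>\<^sub>L complex) \<Rightarrow> ('a \<Rightarrow>\<^sub>L complex)" where
  "left_action a \<mu> = \<mu> o\<^sub>L blinfun_mult_left a"

definition right_action :: "('a::real_normed_algebra \<Rightarrow>\<^sub>L complex) \<Rightarrow> 'a \<Rightarrow> ('a \<Rightarrow>\<^sub>L complex)" where
  "right_action \<mu> a = \<mu> o\<^sub>L blinfun_mult_right a"

lemma scale_fun_apply [simp]: "blinfun_apply (scale_fun c \<mu>) x = c * blinfun_apply \<mu> x"
  by (simp add: scale_fun_def)

lemma left_action_apply [simp]: "blinfun_apply (left_action a \<mu>) x = blinfun_apply \<mu> (x * a)"
  by (simp add: left_action_def)

lemma right_action_apply [simp]: "blinfun_apply (right_action \<mu> a) x = blinfun_apply \<mu> (a * x)"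
  by (simp add: right_action_def)

definition sub_bimodule :: "('a::complex_banach_algebra \<Rightarrow>\<^sub>L complex) set \<Rightarrow> bool" where
  "sub_bimodule E \<longleftrightarrow> E \<subseteq> dual \<and> 0 \<in> E \<and>
     (\<forall>\<mu>\<in>E. \<forall>\<nu>\<in>E. \<mu> + \<nu> \<in> E) \<and> (\<forall>c. \<forall>\<mu>\<in>E. scale_fun c \<mu> \<in> E) \<and>
     (\<forall>a. \<forall>\<mu>\<in>E. left_action a \<mu> \<in> E \<and> right_action \<mu> a \<in> E)"

text \<open>
  The dual of a subspace \<open>E\<close> of \<^const>\<open>dual\<close>. Since \<open>E\<close> is a set and not a type, its elements
  are represented by functions that are undefined outside \<open>E\<close>.
\<close>

definition dual_of :: "('a::complex_banach_algebra \<Rightarrow>\<^sub>L complex) set \<Rightarrow>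
    (('a \<Rightarrow>\<^sub>L complex) \<Rightarrow> complex) set" where
  "dual_of E = {\<Lambda> \<in> extensional E.
     (\<forall>\<mu>\<in>E. \<forall>\<nu>\<in>E. \<Lambda> (\<mu> + \<nu>) = \<Lambda> \<mu> + \<Lambda> \<nu>) \<and>
     (\<forall>c. \<forall>\<mu>\<in>E. \<Lambda> (scale_fun c \<mu>) = c * \<Lambda> \<mu>) \<and>
     (\<exists>K. \<forall>\<mu>\<in>E. cmod (\<Lambda> \<mu>) \<le> K * norm \<mu>)}"

definition dual_norm :: "('a::complex_banach_algebra \<Rightarrow>\<^sub>L complex) set \<Rightarrow>
    (('a \<Rightarrow>\<^sub>L complex) \<Rightarrow> complex) \<Rightarrow> real" where
  "dual_norm E \<Lambda> = (SUP \<mu>\<in>{\<mu>\<in>E. norm \<mu> \<le> 1}. cmod (\<Lambda> \<mu>))"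

definition canonical_map :: "('a::complex_banach_algebra \<Rightarrow>\<^sub>L complex) set \<Rightarrow>
    'a \<Rightarrow> (('a \<Rightarrow>\<^sub>L complex) \<Rightarrow> complex)" where
  "canonical_map E a = (\<lambda>\<mu>\<in>E. blinfun_apply \<mu> a)"

text \<open>
  The canonical map is linear, so its continuity and that of its inverse are expressed by
  the two norm bounds.
\<close>

definition predual :: "('a::complex_banach_algebra \<Rightarrow>\<^sub>L complex) set \<Rightarrow> bool" where
  "predual E \<longleftrightarrow> sub_bimodule E \<and> closed E \<and>
     bij_betw (canonical_map E) UNIV (dual_of E) \<and>
     (\<exists>C. \<forall>a. dual_norm E (canonical_map E a) \<le> C * norm a) \<and>
     (\<exists>C. \<forall>a. norm a \<le> C * dual_norm E (canonical_map E a))"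


section \<open>The convolution algebra of a discrete semigroup\<close>

typedef 's l1 = "{a :: 's \<Rightarrow> complex. a abs_summable_on UNIV}"
  morphisms coeff Abs_l1
  by (rule exI[of _ "\<lambda>_. 0"]) simp

setup_lifting type_definition_l1

lemma coeff_abs_summable: "coeff a abs_summable_on UNIV"
  using coeff[of a] by simp

lemma coeff_summable: "coeff a summable_on UNIV"
  using coeff_abs_summable abs_summable_summable by blast

lemma abs_summable_add:
  fixes f g :: "'p \<Rightarrow> complex"
  assumes "f abs_summable_on A" and "g abs_summable_on A"
  shows "(\<lambda>x. f x + g x) abs_summable_on A"
  by (rule summable_on_comparison_test[OF summable_on_add[OF assms]])
    (auto intro: norm_triangle_ineq)

lemma abs_summable_fibres:
  fixes F :: "'p \<Rightarrow> complex" and h :: "'p \<Rightarrow> 's"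
  assumes "F abs_summable_on UNIV"
  shows "(\<lambda>(u, p). F p) abs_summable_on (SIGMA u:UNIV. {p. h p = u})"
proof -
  have b: "bij_betw snd (SIGMA u:UNIV. {p. h p = u}) (UNIV :: 'p set)"
    by (rule bij_betwI[where g = "\<lambda>p. (h p, p)"]) auto
  show ?thesis
    using summable_on_reindex_bij_betw[OF b, of "\<lambda>p. norm (F p)"] assms
    by (simp add: case_prod_unfold)
qed

lemma infsum_fibres:
  fixes F :: "'p \<Rightarrow> 'c::banach" and h :: "'p \<Rightarrow> 's"
  assumes "F summable_on UNIV"
  shows "(\<Sum>\<^sub>\<infinity>u. \<Sum>\<^sub>\<infinity>p\<in>{p. h p = u}. F p) = (\<Sum>\<^sub>\<infinity>p. F p)"
proof -
  have b: "bij_betw snd (SIGMA u:UNIV. {p. h p = u}) (UNIV :: 'p set)"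
    by (rule bij_betwI[where g = "\<lambda>p. (h p, p)"]) auto
  have "(\<lambda>(u, p). F p) summable_on (SIGMA u:UNIV. {p. h p = u})"
    using summable_on_reindex_bij_betw[OF b, of F] assms by (simp add: case_prod_unfold)
  then have "(\<Sum>\<^sub>\<infinity>u. \<Sum>\<^sub>\<infinity>p\<in>{p. h p = u}. F p) = infsum (\<lambda>(u, p). F p) (SIGMA u:UNIV. {p. h p = u})"
    by (rule infsum_Sigma'_banach)
  also have "\<dots> = (\<Sum>\<^sub>\<infinity>p. F p)"
    using infsum_reindex_bij_betw[OF b, of F] by (simp add: case_prod_unfold)
  finally show ?thesis .
qed

lemma fibre_sums:
  fixes F :: "'p \<Rightarrow> complex" and h :: "'p \<Rightarrow> 's"
  assumes F: "F abs_summable_on UNIV"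
  shows "(\<lambda>u. \<Sum>\<^sub>\<infinity>p\<in>{p. h p = u}. F p) abs_summable_on UNIV"
    and "(\<Sum>\<^sub>\<infinity>u. norm (\<Sum>\<^sub>\<infinity>p\<in>{p. h p = u}. F p)) \<le> (\<Sum>\<^sub>\<infinity>p. norm (F p))"
proof -
  define N where "N u = (\<Sum>\<^sub>\<infinity>p\<in>{p. h p = u}. norm (F p))" for u
  have s: "F abs_summable_on {p. h p = u}" for u
    using F summable_on_subset_banach by blast
  have le: "norm (\<Sum>\<^sub>\<infinity>p\<in>{p. h p = u}. F p) \<le> N u" for u
    unfolding N_def using s by (rule norm_infsum_bound)
  have "N abs_summable_on UNIV"
    using abs_summable_fibres[OF F, of h] unfolding Infinite_Sum.abs_summable_on_Sigma_iff N_def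
    by (simp only: prod.case UNIV_I simp_thms)
  then have N: "N summable_on UNIV"
    using abs_summable_summable by blast
  show 1: "(\<lambda>u. \<Sum>\<^sub>\<infinity>p\<in>{p. h p = u}. F p) abs_summable_on UNIV"
    by (rule summable_on_comparison_test[OF N]) (use le in auto)
  have "(\<Sum>\<^sub>\<infinity>u. norm (\<Sum>\<^sub>\<infinity>p\<in>{p. h p = u}. F p)) \<le> (\<Sum>\<^sub>\<infinity>u. N u)"
    by (rule infsum_mono[OF 1 N]) (use le in auto)
  also have "\<dots> = (\<Sum>\<^sub>\<infinity>p. norm (F p))"
    unfolding N_def by (rule infsum_fibres[OF F])
  finally show "(\<Sum>\<^sub>\<infinity>u. norm (\<Sum>\<^sub>\<infinity>p\<in>{p. h p = u}. F p)) \<le> (\<Sum>\<^sub>\<infinity>p. norm (F p))" .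
qed

lemma abs_summable_tensor:
  fixes a :: "'p \<Rightarrow> complex" and b :: "'q \<Rightarrow> complex"
  assumes a: "a abs_summable_on UNIV" and b: "b abs_summable_on UNIV"
  shows "(\<lambda>(s, t). a s * b t) abs_summable_on UNIV"
    and "(\<Sum>\<^sub>\<infinity>(s, t). norm (a s * b t)) = (\<Sum>\<^sub>\<infinity>s. norm (a s)) * (\<Sum>\<^sub>\<infinity>t. norm (b t))"
proof -
  have 1: "(\<lambda>(s, t). a s * b t) abs_summable_on (UNIV \<times> UNIV)"
    unfolding Infinite_Sum.abs_summable_on_Sigma_iff
    using a b by (auto simp: norm_mult infsum_cmult_right' abs_mult
        intro!: summable_on_cmult_right summable_on_cmult_left)
  then show "(\<lambda>(s, t). a s * b t) abs_summable_on UNIV"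
    unfolding UNIV_Times_UNIV .
  have "(\<lambda>(s, t). norm (a s * b t)) summable_on (UNIV \<times> UNIV)"
    using 1 by (simp add: case_prod_unfold)
  from infsum_Sigma'_banach[OF this, symmetric]
  show "(\<Sum>\<^sub>\<infinity>(s, t). norm (a s * b t)) = (\<Sum>\<^sub>\<infinity>s. norm (a s)) * (\<Sum>\<^sub>\<infinity>t. norm (b t))"
    by (simp add: norm_mult infsum_cmult_right' infsum_cmult_left')
qed

instantiation l1 :: (type) real_normed_vector
begin

lift_definition zero_l1 :: "'a l1" is "\<lambda>_. 0" by simp
lift_definition plus_l1 :: "'a l1 \<Rightarrow> 'a l1 \<Rightarrow> 'a l1" is "\<lambda>a b s. a s + b s"
  by (rule abs_summable_add)
lift_definition uminus_l1 :: "'a l1 \<Rightarrow> 'a l1" is "\<lambda>a s. - a s" by simp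
lift_definition minus_l1 :: "'a l1 \<Rightarrow> 'a l1 \<Rightarrow> 'a l1" is "\<lambda>a b s. a s - b s"
  by (simp only: diff_conv_add_uminus, rule abs_summable_add) simp_all
lift_definition scaleR_l1 :: "real \<Rightarrow> 'a l1 \<Rightarrow> 'a l1" is "\<lambda>r a s. r *\<^sub>R a s"
  by (auto intro: summable_on_cmult_right)
lift_definition norm_l1 :: "'a l1 \<Rightarrow> real" is "\<lambda>a. \<Sum>\<^sub>\<infinity>s. norm (a s)" .

definition dist_l1 :: "'a l1 \<Rightarrow> 'a l1 \<Rightarrow> real" where
  "dist_l1 a b = norm (a - b)"
definition sgn_l1 :: "'a l1 \<Rightarrow> 'a l1" where
  "sgn_l1 a = scaleR (inverse (norm a)) a"
definition
  "(uniformity :: ('a l1 \<times> 'a l1) filter) = (INF e\<in>{0<..}. principal {(x, y). dist x y < e})"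
definition open_l1 :: "'a l1 set \<Rightarrow> bool" where
  "open_l1 U = (\<forall>x\<in>U. \<forall>\<^sub>F (x', y) in uniformity. x' = x \<longrightarrow> y \<in> U)"

instance
proof
  fix a b :: "'a l1" and r :: real
  show "(norm a = 0) = (a = 0)"
  proof
    assume "norm a = 0"
    then have "norm (coeff a s) = 0" for s
      by (intro nonneg_infsum_le_0D[where A = UNIV] coeff_abs_summable)
        (auto simp: norm_l1.rep_eq)
    then show "a = 0" by (simp add: coeff_inject[symmetric] zero_l1.rep_eq fun_eq_iff)
  qed (simp add: norm_l1.rep_eq zero_l1.rep_eq)
  have 1: "(\<lambda>s. norm (coeff a s) + norm (coeff b s)) summable_on UNIV"
    by (intro summable_on_add coeff_abs_summable)
  show "norm (a + b) \<le> norm a + norm b"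
    unfolding norm_l1.rep_eq plus_l1.rep_eq
    by (subst infsum_add[symmetric])
      (auto intro!: coeff_abs_summable infsum_mono 1 norm_triangle_ineq abs_summable_add)
  show "norm (r *\<^sub>R a) = \<bar>r\<bar> * norm a"
    unfolding norm_l1.rep_eq scaleR_l1.rep_eq by (simp add: infsum_cmult_right')
qed (rule dist_l1_def sgn_l1_def uniformity_l1_def open_l1_def |
     (transfer; simp add: fun_eq_iff algebra_simps))+

end

lemma coeff_le_norm: "cmod (coeff a s) \<le> norm a"
proof -
  have "(\<Sum>\<^sub>\<infinity>t\<in>{s}. norm (coeff a t)) \<le> norm a"
    unfolding norm_l1.rep_eq
    by (rule infsum_mono_neutral) (auto intro: coeff_abs_summable)
  then show ?thesis by simp
qed

instance l1 :: (type) banach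
proof
  fix X :: "nat \<Rightarrow> 'a l1"
  assume X: "Cauchy X"
  have "Cauchy (\<lambda>n. coeff (X n) s)" for s
    unfolding Cauchy_altdef2 dist_norm
  proof (intro allI impI)
    fix e :: real assume "e > 0"
    then obtain N where N: "\<forall>n\<ge>N. norm (X n - X N) < e"
      using X unfolding Cauchy_altdef2 dist_norm by blast
    have "cmod (coeff (X n) s - coeff (X N) s) < e" if "n \<ge> N" for n
      using N that coeff_le_norm[of "X n - X N" s] by (force simp: minus_l1.rep_eq)
    then show "\<exists>N. \<forall>n\<ge>N. cmod (coeff (X n) s - coeff (X N) s) < e" by blast
  qed
  then have "\<forall>s. \<exists>l. (\<lambda>n. coeff (X n) s) \<longlonglongrightarrow> l"
    using Cauchy_convergent convergent_def by blast
  then obtain x where x: "\<And>s. (\<lambda>n. coeff (X n) s) \<longlonglongrightarrow> x s" by metis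
  have bound: "(\<lambda>s. coeff (X n) s - x s) abs_summable_on UNIV \<and>
      (\<Sum>\<^sub>\<infinity>s. cmod (coeff (X n) s - x s)) \<le> e"
    if e: "\<forall>m\<ge>N. \<forall>n\<ge>N. norm (X m - X n) < e" and n: "n \<ge> N" for e N n
  proof -
    have fin: "(\<Sum>s\<in>F. cmod (coeff (X n) s - x s)) \<le> e" if F: "finite F" for F
    proof (rule LIMSEQ_le_const2)
      show "(\<lambda>m. \<Sum>s\<in>F. cmod (coeff (X n) s - coeff (X m) s)) \<longlonglongrightarrow> (\<Sum>s\<in>F. cmod (coeff (X n) s - x s))"
        by (intro tendsto_intros x)
      have "(\<Sum>s\<in>F. cmod (coeff (X n) s - coeff (X m) s)) \<le> e" if "m \<ge> N" for m
      proof -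
        have "(\<Sum>s\<in>F. cmod (coeff (X n) s - coeff (X m) s)) \<le> norm (X n - X m)"
          unfolding norm_l1.rep_eq minus_l1.rep_eq
          using coeff_abs_summable[of "X n - X m"] F
          by (intro finite_sum_le_infsum) (auto simp: minus_l1.rep_eq)
        also have "\<dots> \<le> e" using e n that by (simp add: less_imp_le)
        finally show ?thesis .
      qed
      then show "\<exists>M. \<forall>m\<ge>M. (\<Sum>s\<in>F. cmod (coeff (X n) s - coeff (X m) s)) \<le> e" by blast
    qed
    have "(\<lambda>s. coeff (X n) s - x s) abs_summable_on UNIV"
      by (rule nonneg_bdd_above_summable_on) (auto intro!: bdd_aboveI[of _ e] fin)
    then show ?thesis using infsum_le_finite_sums[OF _ fin] by auto
  qed
  obtain N1 where N1: "\<forall>m\<ge>N1. \<forall>n\<ge>N1. norm (X m - X n) < 1"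
    using X unfolding Cauchy_def dist_norm by (meson zero_less_one)
  have "(\<lambda>s. - (coeff (X N1) s - x s) + coeff (X N1) s) abs_summable_on UNIV"
    using bound[OF N1, of N1] by (intro abs_summable_add coeff_abs_summable) (simp_all add: norm_minus_commute)
  then have xs: "x abs_summable_on UNIV" by simp
  then have cx: "coeff (Abs_l1 x) = x" by (simp add: Abs_l1_inverse)
  have "X \<longlonglongrightarrow> Abs_l1 x"
  proof (rule LIMSEQ_I)
    fix r :: real assume "r > 0"
    then obtain N where N: "\<forall>m\<ge>N. \<forall>n\<ge>N. norm (X m - X n) < r / 2"
      using X unfolding Cauchy_def dist_norm by (meson half_gt_zero)
    have "norm (X n - Abs_l1 x) < r" if "n \<ge> N" for n
      using bound[OF N that] \<open>r > 0\<close> by (simp add: norm_l1.rep_eq minus_l1.rep_eq cx)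
    then show "\<exists>N. \<forall>n\<ge>N. norm (X n - Abs_l1 x) < r" by blast
  qed
  then show "convergent X" by (auto simp: convergent_def)
qed

instantiation l1 :: (semigroup_mult) complex_banach_algebra
begin

lift_definition times_l1 :: "'a l1 \<Rightarrow> 'a l1 \<Rightarrow> 'a l1" is
  "\<lambda>a b u. \<Sum>\<^sub>\<infinity>(s, t)\<in>{(s, t). s * t = u}. a s * b t"
  subgoal for a b
    using fibre_sums(1)[OF abs_summable_tensor(1), of a b "\<lambda>(s, t). s * t"]
    by (simp add: case_prod_unfold)
  done

lift_definition scaleC_l1 :: "complex \<Rightarrow> 'a l1 \<Rightarrow> 'a l1" is "\<lambda>c a s. c * a s"
  by (auto simp: norm_mult intro: summable_on_cmult_right)

lemma tensor_summable: "(\<lambda>(s, t). coeff a s * coeff b t) summable_on A"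
  using abs_summable_tensor(1)[OF coeff_abs_summable coeff_abs_summable, of a b]
    abs_summable_summable summable_on_subset_banach by blast

lemma l1_eqI: "(\<And>s. coeff a s = coeff b s) \<Longrightarrow> a = b"
  by (simp add: coeff_inject[symmetric] fun_eq_iff)

lemma l1_mult_assoc: "(a * b) * c = a * (b * (c :: 'a l1))"
proof (rule l1_eqI)
  fix u
  let ?T = "\<lambda>(r :: 'a, s :: 'a, t :: 'a). coeff a r * (coeff b s * coeff c t)"
  let ?D = "{(r :: 'a, s :: 'a, t :: 'a). r * s * t = u}"
  have "(\<lambda>(r, p). coeff a r * (case p of (s, t) \<Rightarrow> coeff b s * coeff c t)) abs_summable_on UNIV"
    by (intro abs_summable_tensor coeff_abs_summable)
  then have "?T abs_summable_on UNIV" by (simp add: case_prod_unfold)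
  then have T: "?T summable_on ?D"
    using abs_summable_summable summable_on_subset_banach by blast
  have b1: "bij_betw (\<lambda>((v, t), (r, s)). (r, s, t))
      (SIGMA (v, t):{(v, t). v * t = u}. {(r, s). r * s = v}) ?D"
    by (rule bij_betwI[where g = "\<lambda>(r, s, t). ((r * s, t), (r, s))"]) auto
  have b2: "bij_betw (\<lambda>((r, v), (s, t)). (r, s, t))
      (SIGMA (r, v):{(r, v). r * v = u}. {(s, t). s * t = v}) ?D"
    by (rule bij_betwI[where g = "\<lambda>(r, s, t). ((r, s * t), (s, t))"]) (auto simp: mult.assoc)
  have s1: "(\<lambda>(p, q). ?T (fst q, snd q, snd p)) summable_on
      (SIGMA (v, t):{(v, t). v * t = u}. {(r, s). r * s = v})"
    using T summable_on_reindex_bij_betw[OF b1, of ?T] by (simp add: case_prod_unfold)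
  have s2: "(\<lambda>(p, q). ?T (fst p, fst q, snd q)) summable_on
      (SIGMA (r, v):{(r, v). r * v = u}. {(s, t). s * t = v})"
    using T summable_on_reindex_bij_betw[OF b2, of ?T] by (simp add: case_prod_unfold)
  have "coeff ((a * b) * c) u = infsum ?T ?D"
    unfolding times_l1.rep_eq
    using infsum_reindex_bij_betw[OF b1, of ?T] infsum_Sigma'_banach[OF s1]
    by (simp add: case_prod_unfold infsum_cmult_left'[symmetric] mult.assoc)
  moreover have "coeff (a * (b * c)) u = infsum ?T ?D"
    unfolding times_l1.rep_eq
    using infsum_reindex_bij_betw[OF b2, of ?T] infsum_Sigma'_banach[OF s2]
    by (simp add: case_prod_unfold infsum_cmult_right'[symmetric])
  ultimately show "coeff ((a * b) * c) u = coeff (a * (b * c)) u" by simp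
qed

instance
proof
  fix a b c :: "'a l1" and r :: real and z w :: complex
  show "a * b * c = a * (b * c)" by (rule l1_mult_assoc)
  show "(a + b) * c = a * c + b * c"
    by (rule l1_eqI, unfold times_l1.rep_eq plus_l1.rep_eq, subst infsum_add[symmetric])
      (auto intro!: tensor_summable infsum_cong simp: algebra_simps)
  show "a * (b + c) = a * b + a * c"
    by (rule l1_eqI, unfold times_l1.rep_eq plus_l1.rep_eq, subst infsum_add[symmetric])
      (auto intro!: tensor_summable infsum_cong simp: algebra_simps)
  show scl: "scaleC z a * b = scaleC z (a * b)" for z
    by (rule l1_eqI) (simp add: times_l1.rep_eq scaleC_l1.rep_eq case_prod_unfold
        mult.assoc infsum_cmult_right')
  show scr: "a * scaleC z b = scaleC z (a * b)" for z
    by (rule l1_eqI) (simp add: times_l1.rep_eq scaleC_l1.rep_eq case_prod_unfold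
        mult.left_commute infsum_cmult_right')
  show sR: "scaleC (complex_of_real r) a = r *\<^sub>R a" for r and a :: "'a l1"
    by (rule l1_eqI) (simp add: scaleC_l1.rep_eq scaleR_l1.rep_eq scaleR_conv_of_real)
  show "r *\<^sub>R a * b = r *\<^sub>R (a * b)" using scl[of "of_real r"] by (simp only: sR)
  show "a * r *\<^sub>R b = r *\<^sub>R (a * b)" using scr[of "of_real r"] by (simp only: sR)
  show "norm (a * b) \<le> norm a * norm b"
    using fibre_sums(2)[OF abs_summable_tensor(1)[OF coeff_abs_summable coeff_abs_summable],
        of a b "\<lambda>(s, t). s * t"]
      abs_summable_tensor(2)[OF coeff_abs_summable coeff_abs_summable, of a b]
    by (simp add: norm_l1.rep_eq times_l1.rep_eq case_prod_unfold)
  show "scaleC z (a + b) = scaleC z a + scaleC z b"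
    and "scaleC (z + w) a = scaleC z a + scaleC w a"
    and "scaleC z (scaleC w a) = scaleC (z * w) a"
    by (transfer; simp add: fun_eq_iff algebra_simps)+
  show "norm (scaleC z a) = cmod z * norm a"
    by (simp add: norm_l1.rep_eq scaleC_l1.rep_eq norm_mult infsum_cmult_right')
qed

end

lift_definition \<delta> :: "'s \<Rightarrow> 's l1" is "\<lambda>s t. if t = s then 1 else 0"
proof -
  fix s :: 's
  show "(\<lambda>t. if t = s then 1 else 0 :: complex) abs_summable_on UNIV"
    using summable_on_cong_neutral[of UNIV "{s}" "\<lambda>t. norm (if t = s then 1 else 0 :: complex)" "\<lambda>_. 1"]
    by simp
qed

lemma delta_mult: "\<delta> s * \<delta> t = \<delta> (s * t)"
proof (rule l1_eqI)
  fix u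
  have "coeff (\<delta> s * \<delta> t) u = (\<Sum>\<^sub>\<infinity>p\<in>{(s, t)} \<inter> {(x, y). x * y = u}. 1)"
    unfolding times_l1.rep_eq \<delta>.rep_eq by (rule infsum_cong_neutral) (auto split: if_splits)
  then show "coeff (\<delta> s * \<delta> t) u = coeff (\<delta> (s * t)) u"
    by (auto simp: \<delta>.rep_eq)
qed


section \<open>Bounded functions as functionals, and functions vanishing at infinity\<close>

text \<open>
  The identification of \<open>\<ell>\<^sup>\<infinity>(S)\<close> with the dual of \<open>\<ell>\<^sup>1(S)\<close>; meaningful only
  for bounded \<open>f\<close>, see \<open>linf_functional_apply\<close>.
\<close>

definition linf_functional :: "('s \<Rightarrow> complex) \<Rightarrow> ('s l1 \<Rightarrow>\<^sub>L complex)" where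
  "linf_functional f = Blinfun (\<lambda>a. \<Sum>\<^sub>\<infinity>s. coeff a s * f s)"

lemma coeff_bounded_abs_summable:
  fixes a :: "'s l1"
  assumes "bounded (range f)"
  shows "(\<lambda>s. coeff a s * f s) abs_summable_on UNIV"
proof -
  obtain M where M: "\<And>s. cmod (f s) \<le> M"
    using assms by (auto simp: bounded_iff)
  have "(\<lambda>s. cmod (coeff a s) * M) summable_on UNIV"
    by (intro summable_on_cmult_left coeff_abs_summable)
  then show ?thesis
    by (rule summable_on_comparison_test) (auto simp: norm_mult intro!: mult_left_mono M)
qed

lemma linf_functional_apply:
  fixes a :: "'s l1"
  assumes "bounded (range f)"
  shows "blinfun_apply (linf_functional f) a = (\<Sum>\<^sub>\<infinity>s. coeff a s * f s)"
proof -
  obtain M where M: "\<And>s. cmod (f s) \<le> M"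
    using assms by (auto simp: bounded_iff)
  note s = coeff_bounded_abs_summable[OF assms]
  have sM: "(\<lambda>s. cmod (coeff a s) * M) summable_on UNIV" for a :: "'s l1"
    by (intro summable_on_cmult_left coeff_abs_summable)
  have "bounded_linear (\<lambda>a. \<Sum>\<^sub>\<infinity>s. coeff a s * f s)"
  proof (rule bounded_linear_intro[where K = M])
    fix a b :: "'s l1" and r :: real
    show "(\<Sum>\<^sub>\<infinity>s. coeff (a + b) s * f s) = (\<Sum>\<^sub>\<infinity>s. coeff a s * f s) + (\<Sum>\<^sub>\<infinity>s. coeff b s * f s)"
      using infsum_add[OF abs_summable_summable[OF s[of a]] abs_summable_summable[OF s[of b]]]
      by (simp only: plus_l1.rep_eq distrib_right)
    show "(\<Sum>\<^sub>\<infinity>s. coeff (r *\<^sub>R a) s * f s) = r *\<^sub>R (\<Sum>\<^sub>\<infinity>s. coeff a s * f s)"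
      by (simp add: scaleR_l1.rep_eq infsum_scaleR_right)
    have "cmod (\<Sum>\<^sub>\<infinity>s. coeff a s * f s) \<le> (\<Sum>\<^sub>\<infinity>s. cmod (coeff a s * f s))"
      using s by (rule norm_infsum_bound)
    also have "\<dots> \<le> (\<Sum>\<^sub>\<infinity>s. cmod (coeff a s) * M)"
      by (rule infsum_mono[OF s sM]) (auto simp: norm_mult intro!: mult_left_mono M)
    finally show "cmod (\<Sum>\<^sub>\<infinity>s. coeff a s * f s) \<le> norm a * M"
      by (simp add: norm_l1.rep_eq infsum_cmult_left')
  qed
  then show ?thesis
    by (simp add: linf_functional_def bounded_linear_Blinfun_apply)
qed

lemma linf_functional_in_dual:
  assumes "bounded (range f)"
  shows "linf_functional f \<in> dual"
  by (simp add: dual_def linf_functional_apply[OF assms] scaleC_l1.rep_eq mult.assoc infsum_cmult_right')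

lemma linf_functional_mult:
  assumes f: "bounded (range f)"
  shows "blinfun_apply (linf_functional f) (a * b) =
    (\<Sum>\<^sub>\<infinity>(s, t). coeff a s * coeff b t * f (s * t))"
proof -
  obtain M where M: "\<And>s. cmod (f s) \<le> M"
    using f by (auto simp: bounded_iff)
  have "(\<lambda>p. norm (case p of (s, t) \<Rightarrow> coeff a s * coeff b t) * M) summable_on UNIV"
    by (intro summable_on_cmult_left abs_summable_tensor coeff_abs_summable)
  then have "(\<lambda>(s, t). coeff a s * coeff b t * f (s * t)) abs_summable_on UNIV"
    by (rule summable_on_comparison_test)
      (auto simp: norm_mult intro!: mult_mono M)
  from infsum_fibres[OF abs_summable_summable[OF this], of "\<lambda>(s, t). s * t"]
  have "(\<Sum>\<^sub>\<infinity>(s, t). coeff a s * coeff b t * f (s * t)) =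
    (\<Sum>\<^sub>\<infinity>u. \<Sum>\<^sub>\<infinity>(s, t)\<in>{(s, t). s * t = u}. coeff a s * coeff b t * f (s * t))"
    by (simp add: case_prod_unfold)
  also have "\<dots> = (\<Sum>\<^sub>\<infinity>u. \<Sum>\<^sub>\<infinity>(s, t)\<in>{(s, t). s * t = u}. coeff a s * coeff b t * f u)"
    by (intro infsum_cong) auto
  finally show ?thesis
    by (simp add: linf_functional_apply[OF f] times_l1.rep_eq case_prod_unfold infsum_cmult_left'[symmetric])
qed

lemma left_action_delta:
  assumes f: "bounded (range f)"
  shows "left_action (\<delta> s) (linf_functional f) = linf_functional (\<lambda>t. f (t * s))"
proof (rule blinfun_eqI)
  fix a
  have b: "bounded (range (\<lambda>t. f (t * s)))"
    using f by (rule bounded_subset) auto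
  have "(\<Sum>\<^sub>\<infinity>(r, t). coeff a r * coeff (\<delta> s) t * f (r * t)) =
      (\<Sum>\<^sub>\<infinity>(r, t)\<in>(\<lambda>r. (r, s)) ` UNIV. coeff a r * f (r * t))"
    by (rule infsum_cong_neutral) (auto simp: \<delta>.rep_eq split: if_splits)
  also have "\<dots> = (\<Sum>\<^sub>\<infinity>r. coeff a r * f (r * s))"
    by (subst infsum_reindex) (auto simp: inj_on_def o_def)
  finally show "blinfun_apply (left_action (\<delta> s) (linf_functional f)) a =
      blinfun_apply (linf_functional (\<lambda>t. f (t * s))) a"
    by (simp add: linf_functional_mult[OF f] linf_functional_apply[OF b])
qed

lemma right_action_delta:
  assumes f: "bounded (range f)"
  shows "right_action (linf_functional f) (\<delta> s) = linf_functional (\<lambda>t. f (s * t))"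
proof (rule blinfun_eqI)
  fix a
  have b: "bounded (range (\<lambda>t. f (s * t)))"
    using f by (rule bounded_subset) auto
  have "(\<Sum>\<^sub>\<infinity>(t, r). coeff (\<delta> s) t * coeff a r * f (t * r)) =
      (\<Sum>\<^sub>\<infinity>(t, r)\<in>(\<lambda>r. (s, r)) ` UNIV. coeff a r * f (t * r))"
    by (rule infsum_cong_neutral) (auto simp: \<delta>.rep_eq split: if_splits)
  also have "\<dots> = (\<Sum>\<^sub>\<infinity>r. coeff a r * f (s * r))"
    by (subst infsum_reindex) (auto simp: inj_on_def o_def)
  finally show "blinfun_apply (right_action (linf_functional f) (\<delta> s)) a =
      blinfun_apply (linf_functional (\<lambda>t. f (s * t))) a"
    by (simp add: linf_functional_mult[OF f] linf_functional_apply[OF b])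
qed

lemma linf_functional_delta:
  assumes "bounded (range f)"
  shows "blinfun_apply (linf_functional f) (\<delta> s) = f s"
proof -
  have "(\<Sum>\<^sub>\<infinity>t. coeff (\<delta> s) t * f t) = (\<Sum>\<^sub>\<infinity>t\<in>{s}. f t)"
    by (rule infsum_cong_neutral) (auto simp: \<delta>.rep_eq)
  then show ?thesis by (simp add: linf_functional_apply[OF assms])
qed

definition C0 :: "'s topology \<Rightarrow> ('s \<Rightarrow> complex) set" where
  "C0 \<sigma> = {f. continuous_map \<sigma> euclidean f \<and>
     (\<forall>\<epsilon>>0. \<exists>K. compactin \<sigma> K \<and> (\<forall>s\<in>topspace \<sigma> - K. cmod (f s) < \<epsilon>))}"

lemma C0_bounded:
  assumes "f \<in> C0 \<sigma>" "topspace \<sigma> = UNIV"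
  shows "bounded (range f)"
proof -
  obtain K where K: "compactin \<sigma> K" "\<And>s. s \<notin> K \<Longrightarrow> cmod (f s) < 1"
    using assms unfolding C0_def by (auto dest!: spec[of _ "1::real"])
  have "compact (f ` K)"
    using image_compactin[OF K(1), of euclidean f] assms by (auto simp: C0_def)
  moreover have "range f \<subseteq> f ` K \<union> ball 0 1"
    using K(2) by (force simp: dist_norm)
  ultimately show ?thesis
    by (meson bounded_Un bounded_ball bounded_subset compact_imp_bounded)
qed


section \<open>The semigroup of finite partial injections\<close>

text \<open>
  The value 0 plays the role of ``undefined'', so the support \<open>F\<close> consists of positive numbers.
\<close>

typedef fin_part_inj = "{f :: nat \<Rightarrow> nat. \<exists>F. finite F \<and> F \<subseteq> {1..} \<and>
    inj_on f F \<and> f ` F \<subseteq> {1..} \<and> (\<forall>n. n \<notin> F \<longrightarrow> f n = 0)}"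
  by (rule exI[of _ "\<lambda>_. 0"]) (auto intro!: exI[of _ "{}"])

setup_lifting type_definition_fin_part_inj

instantiation fin_part_inj :: semigroup_mult
begin

lift_definition times_fin_part_inj :: "fin_part_inj \<Rightarrow> fin_part_inj \<Rightarrow> fin_part_inj" is "(\<circ>)"
proof -
  fix f g :: "nat \<Rightarrow> nat"
  assume "\<exists>F. finite F \<and> F \<subseteq> {1..} \<and> inj_on f F \<and> f ` F \<subseteq> {1..} \<and> (\<forall>n. n \<notin> F \<longrightarrow> f n = 0)"
  then obtain F where F: "finite F" "F \<subseteq> {1..}" "inj_on f F" "f ` F \<subseteq> {1..}"
    and F0: "\<And>n. n \<notin> F \<Longrightarrow> f n = 0"
    by (elim exE conjE) simp
  assume "\<exists>F. finite F \<and> F \<subseteq> {1..} \<and> inj_on g F \<and> g ` F \<subseteq> {1..} \<and> (\<forall>n. n \<notin> F \<longrightarrow> g n = 0)"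
  then obtain G where G: "finite G" "G \<subseteq> {1..}" "inj_on g G" "g ` G \<subseteq> {1..}"
    and G0: "\<And>n. n \<notin> G \<Longrightarrow> g n = 0"
    by (elim exE conjE) simp
  define H where "H = {n \<in> G. g n \<in> F}"
  have f0: "f 0 = 0" using F(2) F0[of 0] by (cases "0 \<in> F") auto
  have "finite H" "H \<subseteq> {1..}" using G(1,2) by (auto simp: H_def)
  moreover have "inj_on (f \<circ> g) H"
    using F(3) G(3) by (auto simp: inj_on_def H_def)
  moreover have "(f \<circ> g) ` H \<subseteq> {1..}" using F(4) by (force simp: H_def)
  moreover have "(f \<circ> g) n = 0" if "n \<notin> H" for n
    using that F0[of "g n"] G0[of n] f0 by (cases "n \<in> G") (simp_all add: H_def)
  ultimately show "\<exists>F. finite F \<and> F \<subseteq> {1..} \<and> inj_on (f \<circ> g) F \<and> (f \<circ> g) ` F \<subseteq> {1..} \<and>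
      (\<forall>n. n \<notin> F \<longrightarrow> (f \<circ> g) n = 0)"
    by (intro exI[of _ H] conjI allI impI)
qed

instance
  by standard (transfer, simp add: comp_assoc)

end

end

theory Submission
  imports Defs
begin

text \<open>
  The semigroup has a zero, so translating a function of \<open>C\<^sub>0(S,\<sigma>)\<close> by it gives a constant
  function, and \<open>\<sigma>\<close> must be compact. Let \<open>e\<^sub>n\<close> be the identity on \<open>{1..n}\<close>. Translations are
  \<open>\<sigma>\<close>-continuous, so the decreasing nonempty sets \<open>{u. e\<^sub>n u = e\<^sub>n}\<close> are closed and have a
  common point. Such a point fixes every \<open>k \<ge> 1\<close>, so its support is infinite.
\<close>

lemma linf_functional_inj:
  assumes "linf_functional f = linf_functional g" "bounded (range f)" "bounded (range g)"
  shows "f = g"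
  using assms linf_functional_delta by (metis ext)

text \<open>The right action of \<open>\<delta> s\<close> keeps the translated functional in the
  image of \<open>C0 \<sigma>\<close>; since a bounded function is determined by its values on the
  \<open>\<delta> t\<close>, the translate itself lies in \<open>C0 \<sigma>\<close>.\<close>

lemma C0_translate:
  fixes \<sigma> :: "'s::semigroup_mult topology"
  assumes E: "sub_bimodule (linf_functional ` C0 \<sigma>)"
    and top: "topspace \<sigma> = UNIV" and f: "f \<in> C0 \<sigma>"
  shows "(\<lambda>t. f (s * t)) \<in> C0 \<sigma>"
proof -
  note bf = C0_bounded[OF f top]
  have "linf_functional (\<lambda>t. f (s * t)) \<in> linf_functional ` C0 \<sigma>"
    using E f unfolding sub_bimodule_def right_action_delta[OF bf, symmetric] by blast
  then obtain g where g: "g \<in> C0 \<sigma>" "linf_functional (\<lambda>t. f (s * t)) = linf_functional g"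
    by blast
  moreover have "bounded (range (\<lambda>t. f (s * t)))"
    using bf by (rule bounded_subset) auto
  ultimately show ?thesis
    using linf_functional_inj C0_bounded[OF g(1) top] by metis
qed

text \<open>This is injectivity of the canonical map. Applied to the point masses, it lets
  \<open>C0 \<sigma>\<close> separate points and vanish at no point.\<close>

lemma predual_eqI:
  assumes "predual E" and "\<And>\<mu>. \<mu> \<in> E \<Longrightarrow> blinfun_apply \<mu> a = blinfun_apply \<mu> b"
  shows "a = b"
proof -
  have "canonical_map E a = canonical_map E b"
    using assms(2) by (auto simp: canonical_map_def)
  with assms(1) show ?thesis
    by (auto simp: predual_def bij_betw_def dest: injD)
qed

lemma predual_C0_separates:
  fixes \<sigma> :: "'s::semigroup_mult topology"
  assumes E: "predual (linf_functional ` C0 \<sigma>)" and top: "topspace \<sigma> = UNIV"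
    and eq: "\<And>f. f \<in> C0 \<sigma> \<Longrightarrow> f s = f t"
  shows "s = t"
proof -
  have "\<delta> s = \<delta> t"
    using E by (rule predual_eqI) (auto simp: linf_functional_delta C0_bounded[OF _ top] eq)
  then have "coeff (\<delta> s) s = coeff (\<delta> t) s" by simp
  then show ?thesis by (simp add: \<delta>.rep_eq split: if_splits)
qed

lemma predual_C0_nonvanishing:
  fixes \<sigma> :: "'s::semigroup_mult topology"
  assumes E: "predual (linf_functional ` C0 \<sigma>)" and top: "topspace \<sigma> = UNIV"
  obtains f where "f \<in> C0 \<sigma>" "f s \<noteq> 0"
proof (rule ccontr)
  assume "\<not> thesis"
  then have z: "f s = 0" if "f \<in> C0 \<sigma>" for f
    using that \<open>\<And>f. f \<in> C0 \<sigma> \<Longrightarrow> f s \<noteq> 0 \<Longrightarrow> thesis\<close> by blast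
  have "\<delta> s = 0"
    using E by (rule predual_eqI) (auto simp: linf_functional_delta C0_bounded[OF _ top] z blinfun.zero_right)
  then have "coeff (\<delta> s) s = coeff 0 s" by simp
  then show False by (simp add: \<delta>.rep_eq zero_l1.rep_eq)
qed

lemma predual_C0_compact:
  fixes \<sigma> :: "'s::semigroup_mult topology" and z :: 's
  assumes E: "predual (linf_functional ` C0 \<sigma>)" and top: "topspace \<sigma> = UNIV"
    and z: "\<And>t. z * t = z"
  shows "compact_space \<sigma>"
proof -
  obtain f where f: "f \<in> C0 \<sigma>" "f z \<noteq> 0"
    using predual_C0_nonvanishing[OF E top] .
  have "(\<lambda>t. f z) \<in> C0 \<sigma>"
    using C0_translate[OF _ top f(1), of z] E by (simp add: z predual_def)
  \<comment> \<open>Taking \<open>\<epsilon> = cmod (f z)\<close> in the decay condition for the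
    constant \<open>f z\<close> leaves no point outside \<open>K\<close>.\<close>
  then obtain K where "compactin \<sigma> K" "\<forall>s\<in>topspace \<sigma> - K. cmod (f z) < cmod (f z)"
    using f(2) unfolding C0_def by (smt (verit) mem_Collect_eq zero_less_norm_iff)
  moreover from this have "K = topspace \<sigma>"
    using compactin_subset_topspace by fastforce
  ultimately show ?thesis
    by (simp add: compact_space_def)
qed

text \<open>Since \<open>C0 \<sigma>\<close> separates points, the equation \<open>s * u = t\<close>
  amounts to the conditions \<open>f (s * u) = f t\<close> for all \<open>f\<close> in
  \<open>C0 \<sigma>\<close>, each closed because the translate of \<open>f\<close> is
  continuous.\<close>

lemma predual_C0_closedin_translate:
  fixes \<sigma> :: "'s::semigroup_mult topology"
  assumes E: "predual (linf_functional ` C0 \<sigma>)" and top: "topspace \<sigma> = UNIV"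
  shows "closedin \<sigma> {u. s * u = t}"
proof -
  have "{u. s * u = t} = (\<Inter>f\<in>C0 \<sigma>. {u. f (s * u) = f t})"
    using predual_C0_separates[OF E top] by blast
  moreover have "closedin \<sigma> {u. f (s * u) = f t}" if "f \<in> C0 \<sigma>" for f
  proof -
    have "continuous_map \<sigma> euclidean (\<lambda>u. f (s * u))"
      using C0_translate[OF _ top that] E by (simp add: predual_def C0_def)
    from closedin_continuous_map_preimage[OF this, of "{f t}"]
    show ?thesis by (simp add: top)
  qed
  \<comment> \<open>\<open>closedin_Inter\<close> requires a nonempty family.\<close>
  moreover have "C0 \<sigma> \<noteq> {}"
    using predual_C0_nonvanishing[OF E top] by blast
  ultimately show ?thesis
    by (auto intro!: closedin_Inter)
qed

lift_definition zero_fpi :: fin_part_inj is "\<lambda>_. 0"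
  by (auto intro!: exI[of _ "{}"])

lift_definition id_upto :: "nat \<Rightarrow> fin_part_inj" is "\<lambda>n k. if k \<le> n then k else 0"
proof -
  fix n :: nat
  show "\<exists>F. finite F \<and> F \<subseteq> {1..} \<and> inj_on (\<lambda>k. if k \<le> n then k else 0) F \<and>
      (\<lambda>k. if k \<le> n then k else 0) ` F \<subseteq> {1..} \<and>
      (\<forall>k. k \<notin> F \<longrightarrow> (if k \<le> n then k else 0) = 0)"
    by (rule exI[of _ "{1..n}"]) (auto simp: inj_on_def)
qed

lemma zero_fpi_mult: "zero_fpi * t = zero_fpi"
  by transfer auto

lemma id_upto_mult: "n \<le> m \<Longrightarrow> id_upto n * id_upto m = id_upto n"
  by transfer auto

lemma id_upto_not_all_fixed: "\<exists>n. id_upto n * u \<noteq> id_upto n"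
proof transfer
  fix u :: "nat \<Rightarrow> nat"
  assume "\<exists>F. finite F \<and> F \<subseteq> {1..} \<and> inj_on u F \<and> u ` F \<subseteq> {1..} \<and> (\<forall>n. n \<notin> F \<longrightarrow> u n = 0)"
  then obtain F where "finite F" and F: "\<And>n. n \<notin> F \<Longrightarrow> u n = 0" by blast
  \<comment> \<open>Outside the support \<open>u k = 0\<close>, so \<open>id_upto k * u\<close>
    sends \<open>k\<close> to 0, whereas \<open>id_upto k\<close> fixes \<open>k > 0\<close>. Hence
    \<open>n = k\<close> is a witness.\<close>
  then obtain k where "k \<notin> insert 0 F"
    using ex_new_if_finite[OF infinite_UNIV_nat, of "insert 0 F"] by auto
  with F[of k] have "((\<lambda>j. if j \<le> k then j else 0) \<circ> u) k \<noteq> (if k \<le> k then k else 0)" by simp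
  then show "\<exists>n. (\<lambda>j. if j \<le> n then j else 0) \<circ> u \<noteq> (\<lambda>j. if j \<le> n then j else 0)"
    by metis
qed

theorem theorem4p2:
  shows "\<not> (\<exists>\<sigma> :: fin_part_inj topology. topspace \<sigma> = UNIV \<and>
    locally_compact_space \<sigma> \<and> Hausdorff_space \<sigma> \<and>
    predual (linf_functional ` C0 \<sigma> :: (fin_part_inj l1 \<Rightarrow>\<^sub>L complex) set))"
proof clarify
  fix \<sigma> :: "fin_part_inj topology"
  assume top: "topspace \<sigma> = UNIV"
    and E: "predual (linf_functional ` C0 \<sigma> :: (fin_part_inj l1 \<Rightarrow>\<^sub>L complex) set)"
  define A where "A n = {u. id_upto n * u = id_upto n}" for n
  \<comment> \<open>Write e_n for \<open>id_upto n\<close>. If e_m u = e_m, then e_n u = e_n e_m u =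
    e_n e_m = e_n.\<close>
  have "A m \<subseteq> A n" if "n \<le> m" for m n
    unfolding A_def using id_upto_mult[OF that] mult.assoc by (smt (verit) mem_Collect_eq subsetI)
  \<comment> \<open>By idempotence \<open>id_upto n\<close> itself lies in
    \<open>A n\<close>.\<close>
  moreover have "A n \<noteq> {}" for n
    using id_upto_mult[of n n] by (auto simp: A_def)
  ultimately have "(\<Inter>n. A n) \<noteq> {}"
    using predual_C0_compact[OF E top zero_fpi_mult] predual_C0_closedin_translate[OF E top]
    by (intro compact_space_imp_nest[of \<sigma> A]) (auto simp: A_def decseq_def)
  then show False
    using id_upto_not_all_fixed by (auto simp: A_def)
qed

end
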